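(* Every finite abelian group is the chirality group of some orientably regular hypermap.
   Context: Let $\Delta=\langle r_0,r_1,r_2\mid r_0^2=r_1^2=r_2^2=1\rangle$ and let $\Delta^+$ be its index-$2$ subgroup of even-length words, generated by $\rho=r_1r_2$ and $\lambda=r_2r_0$. An (oriented) hypermap is a triple $\mathcal H=(D,R,L)$ where $D$ is a finite set and $R,L$ are permutations of $D$ such that the monodromy group $\mathrm{Mon}(\mathcal H)=\langle R,L\rangle$ acts transitively on $D$. It is orientably regular if its automorphism group (permutations of $D$ commuting with $R$ and $L$) acts regularly on $D$; every orientably regular hypermap is isomorphic to $(\Delta^+/H,\rho,\lambda)$, with $\rho,\lambda$ acting by left multiplication on cosets, for a unique normal subgroup $H$ of finite index in $\Delta^+$ (its hypermap subgroup), and every such $H$ arises. For $H\trianglelefteq\Delta^+$ put $H^r=r_2Hr_2$ (equal to $r_iHr_i$ for each $i$). The chirality group of $\mathcal H$ is $X(\mathcal H)=HH^r/H$ (which is isomorphic to $H/(H\cap H^r)$). *)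

theory Defs
  imports "HOL-Algebra.Bij" "HOL-Algebra.Coset" "HOL-Algebra.Generated_Groups"
begin

datatype gen = R0 | R1 | R2

(* Since every generator is an involution, inverse letters are not needed: a word is a list of
   generators, and two words are equal in the group iff they are related by inserting and
   deleting squares of generators.  See Delta_universal below. *)
inductive word_eq :: "gen list \<Rightarrow> gen list \<Rightarrow> bool" where
  word_refl: "word_eq u u"
| word_sym: "word_eq u v \<Longrightarrow> word_eq v u"
| word_trans: "word_eq u v \<Longrightarrow> word_eq v w \<Longrightarrow> word_eq u w"
| word_square: "word_eq (u @ [i, i] @ v) (u @ v)"

definition word_class :: "gen list \<Rightarrow> gen list set" where
  "word_class u = {v. word_eq u v}"

definition Delta :: "gen list set monoid" where
  "Delta =
     \<lparr> carrier = range word_class,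
       mult = (\<lambda>A B. {w. \<exists>u\<in>A. \<exists>v\<in>B. word_eq (u @ v) w}),
       one = word_class [] \<rparr>"

definition Delta_gen :: "gen \<Rightarrow> gen list set" where
  "Delta_gen i = word_class [i]"

definition Delta_plus :: "gen list set monoid" where
  "Delta_plus = Delta\<lparr>carrier := {word_class w | w. even (length w)}\<rparr>"

definition rho :: "gen list set" where
  "rho = Delta_gen R1 \<otimes>\<^bsub>Delta\<^esub> Delta_gen R2"

definition lam :: "gen list set" where
  "lam = Delta_gen R2 \<otimes>\<^bsub>Delta\<^esub> Delta_gen R0"

record 'd hypermap =
  darts :: "'d set"
  rotR :: "'d \<Rightarrow> 'd"
  rotL :: "'d \<Rightarrow> 'd"

(* Permutations of the dart set are elements of the group BijGroup, hence undefined off the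
   dart set. *)
definition Mon :: "'d hypermap \<Rightarrow> ('d \<Rightarrow> 'd) set" where
  "Mon M = generate (BijGroup (darts M)) {rotR M, rotL M}"

definition is_hypermap :: "'d hypermap \<Rightarrow> bool" where
  "is_hypermap M \<longleftrightarrow>
     finite (darts M) \<and> darts M \<noteq> {} \<and>
     rotR M \<in> Bij (darts M) \<and> rotL M \<in> Bij (darts M) \<and>
     (\<forall>x\<in>darts M. \<forall>y\<in>darts M. \<exists>g\<in>Mon M. g x = y)"

definition hypermap_aut :: "'d hypermap \<Rightarrow> ('d \<Rightarrow> 'd) set" where
  "hypermap_aut M =
     {f \<in> Bij (darts M).
        \<forall>x\<in>darts M. f (rotR M x) = rotR M (f x) \<and> f (rotL M x) = rotL M (f x)}"

definition orientably_regular :: "'d hypermap \<Rightarrow> bool" where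
  "orientably_regular M \<longleftrightarrow>
     is_hypermap M \<and>
     (\<forall>x\<in>darts M. \<forall>y\<in>darts M. \<exists>!f. f \<in> hypermap_aut M \<and> f x = y)"

definition hypermap_iso :: "'d hypermap \<Rightarrow> 'e hypermap \<Rightarrow> bool" where
  "hypermap_iso M N \<longleftrightarrow>
     (\<exists>f. bij_betw f (darts M) (darts N) \<and>
        (\<forall>x\<in>darts M. f (rotR M x) = rotR N (f x) \<and> f (rotL M x) = rotL N (f x)))"

definition coset_hypermap :: "gen list set set \<Rightarrow> gen list set set hypermap" where
  "coset_hypermap H =
     (let D = carrier (Delta_plus Mod H)
      in \<lparr> darts = D,
           rotR = (\<lambda>C\<in>D. rho <#\<^bsub>Delta_plus\<^esub> C),
           rotL = (\<lambda>C\<in>D. lam <#\<^bsub>Delta_plus\<^esub> C) \<rparr>)"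

definition is_hypermap_subgroup :: "'d hypermap \<Rightarrow> gen list set set \<Rightarrow> bool" where
  "is_hypermap_subgroup M H \<longleftrightarrow>
     H \<lhd> Delta_plus \<and> finite (carrier (Delta_plus Mod H)) \<and>
     hypermap_iso M (coset_hypermap H)"

(* Meaningful for orientably regular hypermaps only, since only these are isomorphic to a coset
   hypermap of a normal subgroup; for uniqueness see is_hypermap_subgroup_unique below. *)
definition hypermap_subgroup :: "'d hypermap \<Rightarrow> gen list set set" where
  "hypermap_subgroup M = (THE H. is_hypermap_subgroup M H)"

(* H is normal in Delta_plus, so conjugation by any of the three generators gives the same group. *)
definition reflected :: "gen list set set \<Rightarrow> gen list set set" where
  "reflected H = (Delta_gen R2 <#\<^bsub>Delta\<^esub> H) #>\<^bsub>Delta\<^esub> Delta_gen R2"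

definition chirality_group :: "'d hypermap \<Rightarrow> gen list set set monoid" where
  "chirality_group M =
     (let H = hypermap_subgroup M
      in Delta\<lparr>carrier := H <#>\<^bsub>Delta\<^esub> reflected H\<rparr> Mod H)"


lemma word_eq_append:
  assumes "word_eq u u'" "word_eq v v'"
  shows "word_eq (u @ v) (u' @ v')"
proof -
  have l: "word_eq (w @ u) (w @ u')" if "word_eq u u'" for u u' w
    using that
  proof (induction rule: word_eq.induct)
    case (word_square u i v)
    show ?case using word_eq.word_square[of "w @ u" i v] by simp
  qed (auto intro: word_eq.intros)
  have r: "word_eq (u @ w) (u' @ w)" if "word_eq u u'" for u u' w
    using that
  proof (induction rule: word_eq.induct)
    case (word_square u i v)
    show ?case using word_eq.word_square[of u i "v @ w"] by simp
  qed (auto intro: word_eq.intros)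
  show ?thesis using word_trans[OF r[OF assms(1)] l[OF assms(2)]] .
qed

lemma word_class_eq_iff: "word_class u = word_class v \<longleftrightarrow> word_eq u v"
  unfolding word_class_def by (auto intro: word_eq.intros)

lemma word_class_mult: "word_class u \<otimes>\<^bsub>Delta\<^esub> word_class v = word_class (u @ v)"
  unfolding Delta_def word_class_def
  by (auto intro: word_eq_append word_trans word_refl word_sym)

lemma word_eq_rev: "word_eq (rev w @ w) []"
proof (induction w)
  case Nil
  show ?case by (simp add: word_refl)
next
  case (Cons i w)
  show ?case
    using word_trans[OF word_square[of "rev w" i w] Cons.IH] by simp
qed

lemma group_Delta: "group Delta"
proof (rule groupI)
  fix x y assume "x \<in> carrier Delta" "y \<in> carrier Delta"
  then show "x \<otimes>\<^bsub>Delta\<^esub> y \<in> carrier Delta"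
    by (auto simp: Delta_def word_class_mult[unfolded Delta_def, simplified])
next
  show "\<one>\<^bsub>Delta\<^esub> \<in> carrier Delta" by (simp add: Delta_def)
next
  fix x y z assume "x \<in> carrier Delta" "y \<in> carrier Delta" "z \<in> carrier Delta"
  then obtain u v w where "x = word_class u" "y = word_class v" "z = word_class w"
    by (auto simp: Delta_def)
  then show "x \<otimes>\<^bsub>Delta\<^esub> y \<otimes>\<^bsub>Delta\<^esub> z = x \<otimes>\<^bsub>Delta\<^esub> (y \<otimes>\<^bsub>Delta\<^esub> z)"
    by (simp add: word_class_mult)
next
  fix x assume "x \<in> carrier Delta"
  then obtain u where u: "x = word_class u" by (auto simp: Delta_def)
  have one: "\<one>\<^bsub>Delta\<^esub> = word_class []" by (simp add: Delta_def)
  show "\<one>\<^bsub>Delta\<^esub> \<otimes>\<^bsub>Delta\<^esub> x = x" by (simp add: one u word_class_mult)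
  have "word_class (rev u) \<otimes>\<^bsub>Delta\<^esub> x = \<one>\<^bsub>Delta\<^esub>"
    by (simp add: one u word_class_mult word_class_eq_iff word_eq_rev)
  moreover have "word_class (rev u) \<in> carrier Delta" by (simp add: Delta_def)
  ultimately show "\<exists>y\<in>carrier Delta. y \<otimes>\<^bsub>Delta\<^esub> x = \<one>\<^bsub>Delta\<^esub>" by blast
qed

lemma Delta_universal:
  assumes "group G" "\<And>i. f i \<in> carrier G" "\<And>i. f i \<otimes>\<^bsub>G\<^esub> f i = \<one>\<^bsub>G\<^esub>"
  shows "\<exists>h\<in>hom Delta G. \<forall>i. h (Delta_gen i) = f i"
proof -
  interpret group G by fact
  define ev where "ev w = foldr (\<lambda>i x. f i \<otimes>\<^bsub>G\<^esub> x) w \<one>\<^bsub>G\<^esub>" for w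
  have ev_closed: "ev w \<in> carrier G" for w
    by (induction w) (auto simp: ev_def assms(2))
  have ev_Cons: "ev (i # w) = f i \<otimes>\<^bsub>G\<^esub> ev w" for i w by (simp add: ev_def)
  have ev_append: "ev (u @ v) = ev u \<otimes>\<^bsub>G\<^esub> ev v" for u v
  proof (induction u)
    case Nil
    show ?case using ev_closed by (simp add: ev_def[of "[]"])
  next
    case (Cons i u)
    then show ?case by (simp add: ev_Cons m_assoc ev_closed assms(2))
  qed
  have ev_cong: "ev u = ev v" if "word_eq u v" for u v
    using that
  proof (induction rule: word_eq.induct)
    case (word_square u i v)
    have "ev [i, i] = \<one>\<^bsub>G\<^esub>" by (simp add: ev_def assms)
    then show ?case by (simp only: ev_append l_one ev_closed)
  qed auto
  define h where "h A = ev (SOME w. w \<in> A)" for A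
  have h: "h (word_class w) = ev w" for w
  proof -
    have "w \<in> word_class w" by (simp add: word_class_def word_refl)
    then have "(SOME v. v \<in> word_class w) \<in> word_class w" by (rule someI)
    then show ?thesis unfolding h_def by (metis ev_cong mem_Collect_eq word_class_def)
  qed
  have "h \<in> hom Delta G"
  proof (rule homI)
    fix x assume "x \<in> carrier Delta"
    then show "h x \<in> carrier G" by (auto simp: Delta_def h ev_closed)
  next
    fix x y assume "x \<in> carrier Delta" "y \<in> carrier Delta"
    then obtain u v where "x = word_class u" "y = word_class v" by (auto simp: Delta_def)
    then show "h (x \<otimes>\<^bsub>Delta\<^esub> y) = h x \<otimes>\<^bsub>G\<^esub> h y" by (simp add: word_class_mult h ev_append)
  qed
  moreover have "h (Delta_gen i) = f i" for i
    by (simp add: Delta_gen_def h ev_def assms)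
  ultimately show ?thesis by blast
qed

lemma subgroup_even: "subgroup {word_class w | w. even (length w)} Delta"
proof -
  interpret group Delta by (rule group_Delta)
  have inv: "inv\<^bsub>Delta\<^esub> (word_class w) = word_class (rev w)" for w
  proof (rule inv_equality)
    show "word_class (rev w) \<otimes>\<^bsub>Delta\<^esub> word_class w = \<one>\<^bsub>Delta\<^esub>"
      by (simp add: Delta_def word_class_mult[unfolded Delta_def, simplified] word_class_eq_iff word_eq_rev)
  qed (simp_all add: Delta_def)
  show ?thesis
  proof (rule subgroupI)
    show "{word_class w | w. even (length w)} \<subseteq> carrier Delta" by (auto simp: Delta_def)
    have "word_class [] \<in> {word_class w | w. even (length w)}" by force
    then show "{word_class w | w. even (length w)} \<noteq> {}" by blast
  next
    fix a assume "a \<in> {word_class w | w. even (length w)}"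
    then show "inv\<^bsub>Delta\<^esub> a \<in> {word_class w | w. even (length w)}"
      by (auto simp: inv)
  next
    fix a b assume "a \<in> {word_class w | w. even (length w)}" "b \<in> {word_class w | w. even (length w)}"
    then show "a \<otimes>\<^bsub>Delta\<^esub> b \<in> {word_class w | w. even (length w)}"
      by (auto simp: word_class_mult)
  qed
qed

lemma group_Delta_plus: "group Delta_plus"
  unfolding Delta_plus_def by (rule subgroup.subgroup_is_group[OF subgroup_even group_Delta])

lemma Delta_plus_generated: "carrier Delta_plus = generate Delta_plus {rho, lam}"
proof
  interpret P: group Delta_plus by (rule group_Delta_plus)
  have mult: "word_class u \<otimes>\<^bsub>Delta_plus\<^esub> word_class v = word_class (u @ v)" for u v
    by (simp add: Delta_plus_def word_class_mult)
  have one: "\<one>\<^bsub>Delta_plus\<^esub> = word_class []" by (simp add: Delta_plus_def Delta_def)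
  have rho: "rho = word_class [R1, R2]" by (simp add: rho_def Delta_gen_def word_class_mult)
  have lam: "lam = word_class [R2, R0]" by (simp add: lam_def Delta_gen_def word_class_mult)
  have cl: "word_class w \<in> carrier Delta_plus" if "even (length w)" for w
    using that by (auto simp: Delta_plus_def)
  have sub: "{rho, lam} \<subseteq> carrier Delta_plus" by (auto simp: rho lam intro!: cl)
  show "generate Delta_plus {rho, lam} \<subseteq> carrier Delta_plus"
    by (rule P.generate_incl[OF sub])
  interpret G: subgroup "generate Delta_plus {rho, lam}" Delta_plus
    by (rule P.generate_is_subgroup[OF sub])
  let ?G = "generate Delta_plus {rho, lam}"
  have cancel: "word_class [i, i] = word_class []" for i
    using word_square[of "[]" i "[]"] by (simp add: word_class_eq_iff)
  have inv: "word_class [j, i] \<in> ?G" if "word_class [i, j] \<in> ?G" for i j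
  proof -
    have "word_eq ([j, i] @ [i, j]) []" using word_eq_rev[of "[i, j]"] by simp
    then have "inv\<^bsub>Delta_plus\<^esub> (word_class [i, j]) = word_class [j, i]"
      by (intro P.inv_equality) (auto simp: mult one word_class_eq_iff intro!: cl)
    then show ?thesis using G.m_inv_closed[OF that] by simp
  qed
  have 12: "word_class [R1, R2] \<in> ?G" and 20: "word_class [R2, R0] \<in> ?G"
    unfolding rho[symmetric] lam[symmetric] by (auto intro: generate.incl)
  have "word_class [R1, R2] \<otimes>\<^bsub>Delta_plus\<^esub> word_class [R2, R0] \<in> ?G" using 12 20 by (rule G.m_closed)
  moreover have "word_class ([R1, R2] @ [R2, R0]) = word_class [R1, R0]"
    using word_square[of "[R1]" R2 "[R0]"] by (simp add: word_class_eq_iff)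
  ultimately have 10: "word_class [R1, R0] \<in> ?G" by (simp add: mult)
  have self: "word_class [i, i] \<in> ?G" for i
    using G.one_closed by (simp add: cancel one)
  have pair: "word_class [i, j] \<in> ?G" for i j
    using 12 20 10 inv[OF 12] inv[OF 20] inv[OF 10] self by (cases i; cases j) auto
  have "word_class w \<in> ?G" if "even (length w)" for w
    using that
  proof (induction w rule: induct_list012)
    case 1
    show ?case using G.one_closed by (simp add: one)
  next
    case (3 i j w)
    then have "word_class [i, j] \<otimes>\<^bsub>Delta_plus\<^esub> word_class w \<in> ?G"
      by (intro G.m_closed pair) auto
    then show ?case by (simp add: mult)
  qed simp
  then show "carrier Delta_plus \<subseteq> ?G" by (auto simp: Delta_plus_def)
qed

lemma hypermap_subgroup_le:
  assumes M: "is_hypermap M" and H: "is_hypermap_subgroup M H" and K: "is_hypermap_subgroup M K"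
  shows "H \<subseteq> K"
proof
  interpret P: group Delta_plus by (rule group_Delta_plus)
  interpret H: normal H Delta_plus using H by (simp add: is_hypermap_subgroup_def)
  interpret K: normal K Delta_plus using K by (simp add: is_hypermap_subgroup_def)
  let ?P = "Delta_plus"
  let ?D = "\<lambda>H. carrier (?P Mod H)"
  have sub: "rho \<in> carrier ?P" "lam \<in> carrier ?P"
    unfolding Delta_plus_generated by (auto intro: generate.incl)
  have D: "?D N = {a <#\<^bsub>?P\<^esub> N | a. a \<in> carrier ?P}" if "N \<lhd> ?P" for N
    using normal.coset_eq[OF that] by (auto simp: FactGroup_def RCOSETS_def)
  have act: "a <#\<^bsub>?P\<^esub> C \<in> ?D N" if N0: "N \<lhd> ?P" and a: "a \<in> carrier ?P" and C: "C \<in> ?D N" for N a C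
  proof -
    have N: "N \<subseteq> carrier ?P" using that(1) normal_imp_subgroup subgroup.subset by blast
    obtain b where b: "b \<in> carrier ?P" "C = b <#\<^bsub>?P\<^esub> N" using C unfolding D[OF N0] by auto
    have "a <#\<^bsub>?P\<^esub> C = (a \<otimes>\<^bsub>?P\<^esub> b) <#\<^bsub>?P\<^esub> N"
      using b a N by (simp add: P.lcos_m_assoc)
    then show ?thesis using a b P.m_closed unfolding D[OF N0] by blast
  qed
  have D_sub: "C \<subseteq> carrier ?P" if N0: "N \<lhd> ?P" and C: "C \<in> ?D N" for N C
  proof -
    have N: "N \<subseteq> carrier ?P" using that(1) normal_imp_subgroup subgroup.subset by blast
    obtain b where "b \<in> carrier ?P" "C = b <#\<^bsub>?P\<^esub> N" using C unfolding D[OF N0] by auto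
    then show ?thesis using P.l_coset_subset_G[OF N] by simp
  qed
  have NH: "H \<lhd> ?P" and NK: "K \<lhd> ?P" by unfold_locales
  have rot: "rotR M x \<in> darts M" "rotL M x \<in> darts M" if "x \<in> darts M" for x
    using M that unfolding is_hypermap_def by (blast dest: Bij_imp_funcset)+
  have ex: "\<exists>f. bij_betw f (darts M) (?D N) \<and>
      (\<forall>x\<in>darts M. f (rotR M x) = rho <#\<^bsub>?P\<^esub> f x \<and> f (rotL M x) = lam <#\<^bsub>?P\<^esub> f x)"
    if N: "is_hypermap_subgroup M N" for N
  proof -
    obtain f where f: "bij_betw f (darts M) (?D N)"
      "\<forall>x\<in>darts M. f (rotR M x) = rotR (coset_hypermap N) (f x) \<and>
                   f (rotL M x) = rotL (coset_hypermap N) (f x)"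
      using N by (auto simp: is_hypermap_subgroup_def hypermap_iso_def coset_hypermap_def Let_def)
    have "f x \<in> ?D N" if "x \<in> darts M" for x using f(1) that by (rule bij_betw_apply)
    then show ?thesis using f by (auto simp: coset_hypermap_def Let_def)
  qed
  obtain f where f: "bij_betw f (darts M) (?D H)"
    "\<And>x. x \<in> darts M \<Longrightarrow> f (rotR M x) = rho <#\<^bsub>?P\<^esub> f x"
    "\<And>x. x \<in> darts M \<Longrightarrow> f (rotL M x) = lam <#\<^bsub>?P\<^esub> f x"
    using ex[OF H] by blast
  obtain g where g: "bij_betw g (darts M) (?D K)"
    "\<And>x. x \<in> darts M \<Longrightarrow> g (rotR M x) = rho <#\<^bsub>?P\<^esub> g x"
    "\<And>x. x \<in> darts M \<Longrightarrow> g (rotL M x) = lam <#\<^bsub>?P\<^esub> g x"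
    using ex[OF K] by blast
  have fD: "f x \<in> ?D H" and gD: "g x \<in> ?D K" if "x \<in> darts M" for x
    using f(1) g(1) that by (auto intro: bij_betw_apply)
  define Q where "Q a \<longleftrightarrow> a \<in> carrier ?P \<and>
    (\<forall>x\<in>darts M. \<exists>y\<in>darts M. f y = a <#\<^bsub>?P\<^esub> f x \<and> g y = a <#\<^bsub>?P\<^esub> g x)" for a
  have Q_inv: "Q (inv\<^bsub>?P\<^esub> a)" if Q: "Q a" for a
    unfolding Q_def
  proof (intro conjI ballI)
    have a: "a \<in> carrier ?P" using Q by (simp add: Q_def)
    then show a': "inv\<^bsub>?P\<^esub> a \<in> carrier ?P" by simp
    fix x assume x: "x \<in> darts M"
    have "inv\<^bsub>?P\<^esub> a <#\<^bsub>?P\<^esub> f x \<in> f ` darts M"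
      using act[OF NH a' fD[OF x]] f(1) by (simp add: bij_betw_def)
    then obtain y where y: "y \<in> darts M" "f y = inv\<^bsub>?P\<^esub> a <#\<^bsub>?P\<^esub> f x" by auto
    obtain z where z: "z \<in> darts M" "f z = a <#\<^bsub>?P\<^esub> f y" "g z = a <#\<^bsub>?P\<^esub> g y"
      using Q y(1) by (auto simp: Q_def)
    have "f z = f x"
      using D_sub[OF NH fD[OF x]] a a' by (simp add: z y P.lcos_m_assoc P.lcos_mult_one)
    then have "z = x" using f(1) x z(1) by (auto simp: bij_betw_def inj_on_def)
    then have "inv\<^bsub>?P\<^esub> a <#\<^bsub>?P\<^esub> g x = g y"
      using D_sub[OF NK gD[OF y(1)]] a a' z(3) by (simp add: P.lcos_m_assoc P.lcos_mult_one)
    then show "\<exists>y\<in>darts M. f y = inv\<^bsub>?P\<^esub> a <#\<^bsub>?P\<^esub> f x \<and> g y = inv\<^bsub>?P\<^esub> a <#\<^bsub>?P\<^esub> g x"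
      using y by auto
  qed
  have "Q rho"
    unfolding Q_def by (intro conjI ballI sub, rule bexI[OF _ rot(1)]) (simp_all add: f(2) g(2))
  moreover have "Q lam"
    unfolding Q_def by (intro conjI ballI sub, rule bexI[OF _ rot(2)]) (simp_all add: f(3) g(3))
  ultimately have Q_gen: "Q h" if "h \<in> {rho, lam}" for h using that by blast
  have Q: "Q a" if "a \<in> carrier ?P" for a
    using that unfolding Delta_plus_generated
  proof (induction rule: generate.induct)
    case one
    show ?case unfolding Q_def
    proof (intro conjI ballI)
      fix x assume x: "x \<in> darts M"
      show "\<exists>y\<in>darts M. f y = \<one>\<^bsub>?P\<^esub> <#\<^bsub>?P\<^esub> f x \<and> g y = \<one>\<^bsub>?P\<^esub> <#\<^bsub>?P\<^esub> g x"
        using D_sub[OF NH fD[OF x]] D_sub[OF NK gD[OF x]] x by (auto simp: P.lcos_mult_one)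
    qed simp
  next
    case (incl h)
    then show ?case by (rule Q_gen)
  next
    case (inv h)
    then show ?case by (intro Q_inv Q_gen)
  next
    case (eng a b)
    show ?case unfolding Q_def
    proof (intro conjI ballI)
      have ab: "a \<in> carrier ?P" "b \<in> carrier ?P" using eng.IH by (auto simp: Q_def)
      then show "a \<otimes>\<^bsub>?P\<^esub> b \<in> carrier ?P" by simp
      fix x assume x: "x \<in> darts M"
      obtain y where y: "y \<in> darts M" "f y = b <#\<^bsub>?P\<^esub> f x" "g y = b <#\<^bsub>?P\<^esub> g x"
        using eng.IH(2) x by (auto simp: Q_def)
      obtain z where z: "z \<in> darts M" "f z = a <#\<^bsub>?P\<^esub> f y" "g z = a <#\<^bsub>?P\<^esub> g y"
        using eng.IH(1) y(1) by (auto simp: Q_def)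
      show "\<exists>z\<in>darts M. f z = a \<otimes>\<^bsub>?P\<^esub> b <#\<^bsub>?P\<^esub> f x \<and> g z = a \<otimes>\<^bsub>?P\<^esub> b <#\<^bsub>?P\<^esub> g x"
        using z y ab D_sub[OF NH fD[OF x]] D_sub[OF NK gD[OF x]]
        by (auto simp: P.lcos_m_assoc)
    qed
  qed
  fix h assume h: "h \<in> H"
  have hP: "h \<in> carrier ?P" using h H.subset by blast
  have "H \<in> ?D H"
    unfolding D[OF NH] using P.lcos_mult_one[OF H.subset] P.one_closed by force
  then have "H \<in> f ` darts M" using f(1) by (simp add: bij_betw_def)
  then obtain x where x: "x \<in> darts M" "f x = H" by auto
  obtain y where y: "y \<in> darts M" "f y = h <#\<^bsub>?P\<^esub> f x" "g y = h <#\<^bsub>?P\<^esub> g x"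
    using Q[OF hP] x(1) by (auto simp: Q_def)
  have "h <#\<^bsub>?P\<^esub> H = H"
    using h H.is_subgroup H.coset_eq hP P.coset_join2 by metis
  then have "f y = f x" using y x by simp
  then have "y = x" using f(1) x y(1) by (auto simp: bij_betw_def inj_on_def)
  then have gx: "h <#\<^bsub>?P\<^esub> g x = g x" using y by simp
  obtain b where b: "b \<in> carrier ?P" "g x = b <#\<^bsub>?P\<^esub> K"
    using gD[OF x(1)] unfolding D[OF NK] by auto
  have "b \<in> g x" using b K.one_closed P.r_one unfolding l_coset_def by force
  then have "h \<otimes>\<^bsub>?P\<^esub> b \<in> g x" using gx unfolding l_coset_def by blast
  then obtain k where k: "k \<in> K" "h \<otimes>\<^bsub>?P\<^esub> b = b \<otimes>\<^bsub>?P\<^esub> k"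
    unfolding b(2) l_coset_def by auto
  have "h = b \<otimes>\<^bsub>?P\<^esub> k \<otimes>\<^bsub>?P\<^esub> inv\<^bsub>?P\<^esub> b"
    using P.inv_solve_right[of h "b \<otimes>\<^bsub>?P\<^esub> k" b] b(1) hP k K.subset by auto
  then show "h \<in> K" using K.inv_op_closed2[OF b(1) k(1)] by simp
qed

lemma is_hypermap_subgroup_unique:
  assumes "is_hypermap M" "is_hypermap_subgroup M H" "is_hypermap_subgroup M K"
  shows "H = K"
  using hypermap_subgroup_le assms by blast

end

theory Submission
  imports Defs "HOL-Algebra.Multiplicative_Group" "HOL-Number_Theory.Cong"
begin

text \<open>
  Index the factors of a ring \<open>\<Prod> \<int>/N\<^sub>a\<close> by the elements \<open>a\<close> of the finite abelian group
  \<open>A\<close>, and choose units \<open>u\<^sub>a\<close> modulo \<open>N\<^sub>a\<close>. Let \<open>\<rho>\<close> act on two copies of this ring as translation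
  by 1 and \<open>\<lambda>\<close> as multiplication by \<open>u\<^sub>a\<close> on the first and by the inverse of \<open>u\<^sub>a\<close> on
  the second copy; then \<open>r\<^sub>2\<close> acts by negation together with the exchange of the copies. The translation
  vectors realised by even words form a module over the polynomials in the scaling factor, so the product
  of the linear factors belonging to all other slots isolates one slot, at the price of a fixed
  integer \<open>P\<^sub>a\<close>. As \<open>P\<^sub>a\<close> depends only on the numbers \<open>u\<^sub>b\<close>, and not on the moduli, one may take
  \<open>N\<^sub>a = n P\<^sub>a\<close> with \<open>n = |A|\<close>. If moreover \<open>u\<^sub>a \<equiv> 1\<close> modulo \<open>n\<close>, then the
  translations by multiples \<open>P\<^sub>a q\<^sub>a\<close> are central, and on either copy \<open>q \<mapsto> \<Prod> a ^ q\<^sub>a\<close> is a surjection onto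
  \<open>A\<close>. Let \<open>E\<close> be the group of even words acting as such translations and \<open>H\<close> the kernel on \<open>E\<close> of
  the surjection for the first copy. Its reflection is the kernel for the second copy, so
  \<open>H H\<^sup>r = E\<close> and \<open>E / H \<cong> A\<close>.
\<close>

section \<open>Orientably regular hypermaps from finite groups\<close>

text \<open>The injection \<open>f\<close> only relabels: the Cayley hypermap of \<open>Q\<close>
  can thus have darts of any type, such as numbers, although \<open>Q\<close> will be a quotient
  group.\<close>

locale two_generated_group = group Q for Q (structure) +
  fixes a b :: 'a and f :: "'a \<Rightarrow> 'd"
  assumes gens: "a \<in> carrier Q" "b \<in> carrier Q" "carrier Q = generate Q {a, b}"
    and fin: "finite (carrier Q)" and inj: "inj_on f (carrier Q)"
begin

definition elem_of :: "'d \<Rightarrow> 'a" where "elem_of = inv_into (carrier Q) f"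

definition lmult :: "'a \<Rightarrow> 'd \<Rightarrow> 'd" where
  "lmult g = (\<lambda>d\<in>f ` carrier Q. f (g \<otimes> elem_of d))"

definition cayley_hypermap :: "'d hypermap" where
  "cayley_hypermap = \<lparr> darts = f ` carrier Q, rotR = lmult a, rotL = lmult b \<rparr>"

lemma elem_of_f [simp]: "x \<in> carrier Q \<Longrightarrow> elem_of (f x) = x"
  unfolding elem_of_def by (rule inv_into_f_f[OF inj])

lemma lmult_f [simp]: "x \<in> carrier Q \<Longrightarrow> lmult g (f x) = f (g \<otimes> x)"
  unfolding lmult_def by simp

lemma f_eq_iff [simp]: "x \<in> carrier Q \<Longrightarrow> y \<in> carrier Q \<Longrightarrow> f x = f y \<longleftrightarrow> x = y"
  using inj by (auto simp: inj_on_def)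

lemma bij_betw_elem_of: "bij_betw elem_of (f ` carrier Q) (carrier Q)"
  unfolding elem_of_def by (rule bij_betw_inv_into) (simp add: inj inj_on_imp_bij_betw)

lemma lmult_Bij: "g \<in> carrier Q \<Longrightarrow> lmult g \<in> Bij (f ` carrier Q)"
proof -
  assume g: "g \<in> carrier Q"
  have "bij_betw (lmult g) (f ` carrier Q) (f ` carrier Q)"
  proof (rule bij_betw_imageI)
    show "inj_on (lmult g) (f ` carrier Q)" using g by (auto intro!: inj_onI)
    show "lmult g ` f ` carrier Q = f ` carrier Q"
    proof (intro equalityI subsetI)
      fix y assume "y \<in> f ` carrier Q"
      then obtain x where x: "x \<in> carrier Q" "y = f x" by blast
      have "lmult g (f (inv g \<otimes> x)) = y" using g x by (simp add: m_assoc[symmetric])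
      then show "y \<in> lmult g ` f ` carrier Q"
        using g x by (intro image_eqI[of _ _ "f (inv g \<otimes> x)"]) auto
    qed (use g in auto)
  qed
  then show ?thesis unfolding Bij_def lmult_def by auto
qed

lemma lmult_group_hom: "group_hom Q (BijGroup (f ` carrier Q)) lmult"
proof (intro group_hom.intro group_hom_axioms.intro group_BijGroup homI)
  show "group Q" ..
  fix g h assume g: "g \<in> carrier Q" and h: "h \<in> carrier Q"
  show "lmult g \<in> carrier (BijGroup (f ` carrier Q))"
    using lmult_Bij[OF g] by (simp add: BijGroup_def)
  show "lmult (g \<otimes> h) = lmult g \<otimes>\<^bsub>BijGroup (f ` carrier Q)\<^esub> lmult h"
    using lmult_Bij g h
    by (auto simp: BijGroup_def compose_def fun_eq_iff lmult_def m_assoc)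
qed

text \<open>Left translation is a homomorphism into \<open>BijGroup\<close>, and a homomorphism
  carries the group generated by \<open>a\<close> and \<open>b\<close> onto the group generated by
  their images.\<close>

lemma Mon_cayley_hypermap: "Mon cayley_hypermap = lmult ` carrier Q"
proof -
  have "{a, b} \<subseteq> carrier Q" using gens by simp
  from group_hom.generate_img[OF lmult_group_hom this] show ?thesis
    by (simp add: Mon_def cayley_hypermap_def gens(3)[symmetric])
qed

text \<open>Automorphisms commute with the two generators by definition; induction over
  \<open>generate\<close> extends this to all left translations, so that one value determines the
  whole automorphism.\<close>

lemma aut_commutes:
  assumes \<phi>: "\<phi> \<in> hypermap_aut cayley_hypermap" and g: "g \<in> carrier Q"
  shows "\<forall>x\<in>carrier Q. \<phi> (f (g \<otimes> x)) = lmult g (\<phi> (f x))"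
proof -
  have cl: "\<exists>y\<in>carrier Q. \<phi> (f x) = f y" if "x \<in> carrier Q" for x
    using \<phi> that by (auto simp: hypermap_aut_def cayley_hypermap_def dest!: Bij_imp_funcset)
  have gen: "\<forall>x\<in>carrier Q. \<phi> (f (h \<otimes> x)) = lmult h (\<phi> (f x))" if "h \<in> {a, b}" for h
    using \<phi> that by (auto simp: hypermap_aut_def cayley_hypermap_def)
  have "g \<in> generate Q {a, b}" using g gens(3) by simp
  then show ?thesis
  proof (induction rule: generate.induct)
    case one
    show ?case
    proof
      fix x assume x: "x \<in> carrier Q"
      then obtain y where "y \<in> carrier Q" "\<phi> (f x) = f y" using cl by blast
      with x show "\<phi> (f (\<one> \<otimes> x)) = lmult \<one> (\<phi> (f x))" by simp
    qed
  next
    case (incl h)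
    then show ?case by (rule gen)
  next
    case (inv h)
    then have h: "h \<in> carrier Q" using gens by auto
    show ?case
    proof
      fix x assume x: "x \<in> carrier Q"
      then obtain y where y: "y \<in> carrier Q" "\<phi> (f x) = f y" using cl by blast
      from x h obtain z where z: "z \<in> carrier Q" "\<phi> (f (inv h \<otimes> x)) = f z"
        using cl by (meson inv_closed m_closed)
      have "\<phi> (f (h \<otimes> (inv h \<otimes> x))) = lmult h (\<phi> (f (inv h \<otimes> x)))"
        using gen[OF inv] h x by blast
      then have "f y = f (h \<otimes> z)" using h x y z by (simp add: m_assoc[symmetric])
      then have "y = h \<otimes> z" using h y z by simp
      then show "\<phi> (f (inv h \<otimes> x)) = lmult (inv h) (\<phi> (f x))"
        using h x y z by (simp add: m_assoc[symmetric])
    qed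
  next
    case (eng g h)
    then have gh: "g \<in> carrier Q" "h \<in> carrier Q" using gens(3) by auto
    show ?case
    proof
      fix x assume x: "x \<in> carrier Q"
      then obtain y where y: "y \<in> carrier Q" "\<phi> (f x) = f y" using cl by blast
      show "\<phi> (f (g \<otimes> h \<otimes> x)) = lmult (g \<otimes> h) (\<phi> (f x))"
        using eng.IH gh x y by (simp add: m_assoc)
    qed
  qed
qed

lemma right_mult_aut:
  assumes h: "h \<in> carrier Q"
  shows "(\<lambda>d\<in>f ` carrier Q. f (elem_of d \<otimes> h)) \<in> hypermap_aut cayley_hypermap"
proof -
  let ?\<phi> = "\<lambda>d\<in>f ` carrier Q. f (elem_of d \<otimes> h)"
  have "bij_betw ?\<phi> (f ` carrier Q) (f ` carrier Q)"
  proof (rule bij_betw_imageI)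
    show "inj_on ?\<phi> (f ` carrier Q)" using h by (auto intro!: inj_onI)
    show "?\<phi> ` f ` carrier Q = f ` carrier Q"
    proof (intro equalityI subsetI)
      fix y assume "y \<in> f ` carrier Q"
      then obtain x where x: "x \<in> carrier Q" "y = f x" by blast
      have "?\<phi> (f (x \<otimes> inv h)) = y" using h x by (simp add: m_assoc)
      then show "y \<in> ?\<phi> ` f ` carrier Q"
        using h x by (intro image_eqI[of _ _ "f (x \<otimes> inv h)"]) auto
    qed (use h in auto)
  qed
  then have "?\<phi> \<in> Bij (f ` carrier Q)" by (auto simp: Bij_def)
  then show ?thesis
    using h gens(1,2) by (auto simp: hypermap_aut_def cayley_hypermap_def m_assoc)
qed

lemma orientably_regular_cayley: "orientably_regular cayley_hypermap"
  unfolding orientably_regular_def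
proof
  show "is_hypermap cayley_hypermap"
    unfolding is_hypermap_def Mon_cayley_hypermap
  proof (intro conjI ballI)
    fix x y assume "x \<in> darts cayley_hypermap" "y \<in> darts cayley_hypermap"
    then obtain s t where "s \<in> carrier Q" "t \<in> carrier Q" "x = f s" "y = f t"
      by (auto simp: cayley_hypermap_def)
    then show "\<exists>g\<in>lmult ` carrier Q. g x = y"
      by (intro bexI[of _ "lmult (t \<otimes> inv s)"]) (auto simp: m_assoc)
  qed (use gens fin lmult_Bij in \<open>auto simp: cayley_hypermap_def\<close>)
  show "\<forall>x\<in>darts cayley_hypermap. \<forall>y\<in>darts cayley_hypermap.
      \<exists>!\<phi>. \<phi> \<in> hypermap_aut cayley_hypermap \<and> \<phi> x = y"
  proof (intro ballI)
    fix x y assume "x \<in> darts cayley_hypermap" "y \<in> darts cayley_hypermap"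
    then obtain s t where st: "s \<in> carrier Q" "t \<in> carrier Q" "x = f s" "y = f t"
      by (auto simp: cayley_hypermap_def)
    show "\<exists>!\<phi>. \<phi> \<in> hypermap_aut cayley_hypermap \<and> \<phi> x = y"
    proof (rule ex_ex1I)
      show "\<exists>\<phi>. \<phi> \<in> hypermap_aut cayley_hypermap \<and> \<phi> x = y"
        using right_mult_aut[of "inv s \<otimes> t"] st
        by (intro exI[of _ "\<lambda>d\<in>f ` carrier Q. f (elem_of d \<otimes> (inv s \<otimes> t))"])
          (auto simp: m_assoc[symmetric])
      fix \<phi> \<psi>
      assume \<phi>: "\<phi> \<in> hypermap_aut cayley_hypermap \<and> \<phi> x = y"
        and \<psi>: "\<psi> \<in> hypermap_aut cayley_hypermap \<and> \<psi> x = y"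
      show "\<phi> = \<psi>"
      proof (rule extensionalityI)
        show "\<phi> \<in> extensional (f ` carrier Q)" "\<psi> \<in> extensional (f ` carrier Q)"
          using \<phi> \<psi> by (auto simp: hypermap_aut_def cayley_hypermap_def Bij_def)
        fix d assume "d \<in> f ` carrier Q"
        then obtain r where r: "r \<in> carrier Q" "d = f r" by blast
        \<comment> \<open>Left translation by \<open>r \<otimes> inv s\<close> carries
          \<open>f s\<close> to \<open>f r\<close>, so the common value \<open>y\<close> at
          \<open>f s\<close> forces equal values at \<open>f r\<close>.\<close>
        have rs: "r \<otimes> inv s \<in> carrier Q" and "r \<otimes> inv s \<otimes> s = r"
          using r st by (auto simp: m_assoc)
        then show "\<phi> d = \<psi> d"
          using aut_commutes[of \<phi>, OF _ rs] aut_commutes[of \<psi>, OF _ rs] \<phi> \<psi> st r by metis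
      qed
    qed
  qed
qed

end

section \<open>Realising a normal subgroup of finite index by a hypermap on natural numbers\<close>

lemma nat_hypermap_with_subgroup:
  assumes H: "H \<lhd> Delta_plus" and fin: "finite (carrier (Delta_plus Mod H))"
  shows "\<exists>M :: nat hypermap. orientably_regular M \<and> hypermap_subgroup M = H"
proof -
  interpret P: group Delta_plus by (rule group_Delta_plus)
  interpret H: normal H Delta_plus by fact
  let ?Q = "Delta_plus Mod H"
  let ?c = "\<lambda>x. H #>\<^bsub>Delta_plus\<^esub> x"
  have Q: "group ?Q" by (rule H.factorgroup_is_group)
  have sub: "rho \<in> carrier Delta_plus" "lam \<in> carrier Delta_plus"
    unfolding Delta_plus_generated by (auto intro: generate.incl)
  have hom: "group_hom Delta_plus ?Q ?c"
    using H.r_coset_hom_Mod Q by (intro group_hom.intro group_hom_axioms.intro) auto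
  have car: "carrier ?Q = ?c ` carrier Delta_plus"
    by (auto simp: FactGroup_def RCOSETS_def)
  have "{rho, lam} \<subseteq> carrier Delta_plus" using sub by simp
  from group_hom.generate_img[OF hom this]
  have gen: "carrier ?Q = generate ?Q {?c rho, ?c lam}"
    by (simp add: car Delta_plus_generated[symmetric])
  obtain f :: "gen list set set \<Rightarrow> nat" where f: "inj_on f (carrier ?Q)"
    using finite_imp_inj_to_nat_seg[OF fin] by blast
  interpret C: two_generated_group ?Q "?c rho" "?c lam" f
    using Q fin f gen sub by (auto simp: two_generated_group_def two_generated_group_axioms_def car)
  \<comment> \<open>The rotations of \<open>coset_hypermap\<close> are left translations of sets. By
    normality left and right cosets agree, so these are products in the quotient group.\<close>
  have left: "r <#\<^bsub>Delta_plus\<^esub> X = ?c r \<otimes>\<^bsub>?Q\<^esub> X"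
    if r: "r \<in> carrier Delta_plus" and X: "X \<in> carrier ?Q" for r X
  proof -
    obtain x where x: "x \<in> carrier Delta_plus" "X = ?c x" using X car by auto
    have "?c r \<otimes>\<^bsub>?Q\<^esub> X = ?c (r \<otimes>\<^bsub>Delta_plus\<^esub> x)"
      using r x H.rcos_sum by (simp add: FactGroup_def)
    also have "\<dots> = (r \<otimes>\<^bsub>Delta_plus\<^esub> x) <#\<^bsub>Delta_plus\<^esub> H" using r x H.coset_eq by simp
    also have "\<dots> = r <#\<^bsub>Delta_plus\<^esub> (x <#\<^bsub>Delta_plus\<^esub> H)"
      using r x H.subset by (simp add: P.lcos_m_assoc)
    also have "\<dots> = r <#\<^bsub>Delta_plus\<^esub> X" using x H.coset_eq by simp
    finally show ?thesis by simp
  qed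
  have iso: "hypermap_iso C.cayley_hypermap (coset_hypermap H)"
    unfolding hypermap_iso_def
  proof (intro exI[of _ C.elem_of] conjI ballI)
    show "bij_betw C.elem_of (darts C.cayley_hypermap) (darts (coset_hypermap H))"
      using C.bij_betw_elem_of by (simp add: C.cayley_hypermap_def coset_hypermap_def Let_def)
    fix d assume "d \<in> darts C.cayley_hypermap"
    then obtain X where X: "X \<in> carrier ?Q" "d = f X" by (auto simp: C.cayley_hypermap_def)
    show "C.elem_of (rotR C.cayley_hypermap d) = rotR (coset_hypermap H) (C.elem_of d)"
      "C.elem_of (rotL C.cayley_hypermap d) = rotL (coset_hypermap H) (C.elem_of d)"
      using X sub C.m_closed[OF C.gens(1) X(1)] C.m_closed[OF C.gens(2) X(1)]
      by (simp_all add: C.cayley_hypermap_def coset_hypermap_def Let_def left del: mult_FactGroup)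
  qed
  have "is_hypermap_subgroup C.cayley_hypermap H"
    using H fin iso by (simp add: is_hypermap_subgroup_def)
  moreover have "is_hypermap C.cayley_hypermap"
    using C.orientably_regular_cayley by (simp add: orientably_regular_def)
  ultimately have "hypermap_subgroup C.cayley_hypermap = H"
    unfolding hypermap_subgroup_def
    by (metis is_hypermap_subgroup_unique the_equality)
  then show ?thesis using C.orientably_regular_cayley by blast
qed

section \<open>Affine actions of words\<close>

lemma word_eq_parity: "word_eq v w \<Longrightarrow> even (length v) \<longleftrightarrow> even (length w)"
  by (induction rule: word_eq.induct) auto

lemma inv_word_class: "inv\<^bsub>Delta\<^esub> (word_class w) = word_class (rev w)"
proof -
  interpret group Delta by (rule group_Delta)
  show ?thesis
  proof (rule inv_equality)
    show "word_class (rev w) \<otimes>\<^bsub>Delta\<^esub> word_class w = \<one>\<^bsub>Delta\<^esub>"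
      by (simp add: word_class_mult) (simp add: Delta_def word_class_eq_iff word_eq_rev)
  qed (simp_all add: Delta_def)
qed

text \<open>\<open>P g\<close> is the value at \<open>t = u g\<close> of the polynomial with factors
  \<open>t - u b\<close> for \<open>b \<noteq> g\<close> and \<open>u b * t - 1\<close> for all
  \<open>b\<close>. The former vanish in the other slots of copy \<open>False\<close>, the latter,
  modulo \<open>N a\<close>, in all slots of copy \<open>True\<close>, where
  \<open>t = u' a\<close>.\<close>

locale affine_slots = comm_group A for A (structure) +
  fixes u u' P :: "'a \<Rightarrow> int"
  assumes fin: "finite (carrier A)"
    and P_nz: "a \<in> carrier A \<Longrightarrow> P a \<noteq> 0"
    and u_one: "a \<in> carrier A \<Longrightarrow> [u a = 1] (mod int (order A))"
    and u_inv: "a \<in> carrier A \<Longrightarrow> [u a * u' a = 1] (mod int (order A) * P a)"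
    and P_eq: "a \<in> carrier A \<Longrightarrow>
      P a = (\<Prod>b\<in>carrier A - {a}. u a - u b) * (\<Prod>b\<in>carrier A. u b * u a - 1)"
begin

definition N :: "'a \<Rightarrow> int" where "N a = int (order A) * P a"

definition scal :: "gen \<Rightarrow> 'a \<Rightarrow> bool \<Rightarrow> int" where
  "scal i a s = (if i = R0 then if s then u' a else u a else 1)"

text \<open>\<open>ev w a s x\<close> represents, modulo \<open>N a\<close>, the image under the word \<open>w\<close>, applied from the right,
  of the point \<open>x\<close> of slot \<open>a\<close> in the copy \<open>s\<close>. Every generator exchanges the copies, which is why the
  parity of \<open>w\<close> selects the scaling factor. Multiplication by the inverses \<open>u' a\<close> belongs to \<open>s = True\<close>.\<close>

primrec ev :: "gen list \<Rightarrow> 'a \<Rightarrow> bool \<Rightarrow> int \<Rightarrow> int" where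
  "ev [] a s x = x"
| "ev (i # w) a s x =
     (if i = R1 then 1 else 0) - scal i a (s \<noteq> odd (length w)) * ev w a s x"

lemma order_pos: "order A > 0"
  using fin order_gt_0_iff_finite by blast

lemma N_nz: "a \<in> carrier A \<Longrightarrow> N a \<noteq> 0"
  using P_nz order_pos by (simp add: N_def)

text \<open>A generator exchanges the copies, so its square scales by the factors of both. That
  these are inverse makes it an involution modulo \<open>N a\<close>, see
  \<open>ev_square\<close>.\<close>

lemma scal_inverse:
  "a \<in> carrier A \<Longrightarrow> [scal i a s * scal i a (\<not> s) = 1] (mod N a)"
  using u_inv[of a] by (auto simp: scal_def N_def mult.commute)

lemma scal_one:
  assumes a: "a \<in> carrier A"
  shows "[scal i a s = 1] (mod int (order A))"
proof -
  have "[u a * u' a = 1] (mod int (order A))"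
    using u_inv[OF a] by (rule cong_modulus_mult)
  moreover have "[u a * u' a = 1 * u' a] (mod int (order A))"
    using u_one[OF a] by (rule cong_scalar_right)
  ultimately have "[u' a = 1] (mod int (order A))"
    by (metis cong_sym cong_trans mult_1)
  then show ?thesis using u_one[OF a] by (simp add: scal_def)
qed

text \<open>The factor is 1 modulo the order of \<open>A\<close>, and \<open>N a\<close> is that
  order times \<open>P a\<close>; hence scaling fixes multiples of \<open>P a\<close>.\<close>

lemma scal_P:
  assumes a: "a \<in> carrier A"
  shows "[scal i a s * (P a * y) = P a * y] (mod N a)"
proof -
  have "int (order A) dvd scal i a s - 1"
    using scal_one[OF a] by (simp add: cong_iff_dvd_diff)
  then have "N a dvd (scal i a s - 1) * P a"
    unfolding N_def by (rule mult_dvd_mono) simp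
  then have "N a dvd (scal i a s - 1) * P a * y" by (rule dvd_mult2)
  then show ?thesis by (simp add: cong_iff_dvd_diff algebra_simps)
qed

lemma ev_append: "ev (v @ w) a s x = ev v a (s \<noteq> odd (length w)) (ev w a s x)"
proof (induction v)
  case (Cons i v)
  have "(s \<noteq> odd (length (v @ w))) = ((s \<noteq> odd (length w)) \<noteq> odd (length v))" by auto
  then show ?case using Cons by (simp only: append_Cons ev.simps)
qed simp

lemma ev_cong: "[x = y] (mod m) \<Longrightarrow> [ev w a s x = ev w a s y] (mod m)"
proof (induction w)
  case (Cons i w)
  then show ?case unfolding ev.simps by (intro cong_diff cong_scalar_left cong_refl)
qed simp

lemma ev_square:
  assumes a: "a \<in> carrier A"
  shows "[ev [i, i] a s x = x] (mod N a)"
proof -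
  have "[scal i a s * scal i a (\<not> s) * x = 1 * x] (mod N a)"
    by (intro cong_scalar_right scal_inverse a)
  then show ?thesis by (cases i) (simp_all add: scal_def algebra_simps)
qed

lemma ev_word_eq:
  assumes "word_eq v w" and a: "a \<in> carrier A"
  shows "[ev v a s x = ev w a s x] (mod N a)"
  using assms(1)
proof (induction arbitrary: s x rule: word_eq.induct)
  case (word_square v i w)
  show ?case
    unfolding ev_append[of v] ev_append[of "[i, i]"]
    by (simp del: ev.simps) (intro ev_cong ev_square a)
next
  case (word_trans u v w)
  then show ?case using cong_trans by blast
qed (auto intro: cong_sym)

text \<open>By \<open>scal_P\<close> a multiple of \<open>P a\<close> passes through each letter
  with only a change of sign. So even words commute with translations by such multiples.\<close>

lemma ev_translate:
  assumes a: "a \<in> carrier A"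
  shows "[ev w a s (x + P a * y) = ev w a s x + (-1) ^ length w * (P a * y)] (mod N a)"
proof (induction w)
  case (Cons i w)
  let ?k = "if i = R1 then 1 else 0" and ?c = "scal i a (s \<noteq> odd (length w))"
  have "[?c * ev w a s (x + P a * y) = ?c * (ev w a s x + (-1) ^ length w * (P a * y))] (mod N a)"
    by (intro cong_scalar_left Cons)
  also have "?c * (ev w a s x + (-1) ^ length w * (P a * y)) =
      ?c * ev w a s x + ?c * (P a * ((-1) ^ length w * y))" by (simp add: algebra_simps)
  also have "[\<dots> = ?c * ev w a s x + P a * ((-1) ^ length w * y)] (mod N a)"
    by (intro cong_add cong_refl scal_P a)
  finally have "[?k - ?c * ev w a s (x + P a * y) =
      ?k - (?c * ev w a s x + P a * ((-1) ^ length w * y))] (mod N a)"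
    by (intro cong_diff cong_refl)
  then show ?case by (simp add: algebra_simps)
qed simp

section \<open>The module of translation vectors of even words\<close>

definition shifts :: "gen list \<Rightarrow> ('a \<Rightarrow> bool \<Rightarrow> int) \<Rightarrow> bool" where
  "shifts w c \<longleftrightarrow> even (length w) \<and>
     (\<forall>a\<in>carrier A. \<forall>s x. [ev w a s x = x + c a s] (mod N a))"

lemma shiftsD: "shifts w c \<Longrightarrow> a \<in> carrier A \<Longrightarrow> [ev w a s x = x + c a s] (mod N a)"
  by (simp add: shifts_def)

lemma shifts_even: "shifts w c \<Longrightarrow> even (length w)"
  by (simp add: shifts_def)

lemma shifts_word_eq: "word_eq v w \<Longrightarrow> shifts v c \<Longrightarrow> shifts w c"
  unfolding shifts_def using ev_word_eq word_eq_parity by (meson cong_sym cong_trans)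

lemma shifts_cong:
  assumes "shifts w c" "\<And>a s. a \<in> carrier A \<Longrightarrow> [c a s = d a s] (mod N a)"
  shows "shifts w d"
  unfolding shifts_def
proof (intro conjI ballI allI)
  fix a s x assume a: "a \<in> carrier A"
  have "[ev w a s x = x + c a s] (mod N a)" using shiftsD assms(1) a by blast
  also have "[x + c a s = x + d a s] (mod N a)" using assms(2) a by (intro cong_add) auto
  finally show "[ev w a s x = x + d a s] (mod N a)" .
qed (rule shifts_even[OF assms(1)])

lemma shifts_Nil: "shifts [] (\<lambda>a s. 0)"
  by (simp add: shifts_def)

lemma shifts_append:
  assumes v: "shifts v c" and w: "shifts w d"
  shows "shifts (v @ w) (\<lambda>a s. c a s + d a s)"
  unfolding shifts_def
proof (intro conjI ballI allI)
  show "even (length (v @ w))" using shifts_even v w by simp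
  fix a s x assume a: "a \<in> carrier A"
  have "ev (v @ w) a s x = ev v a s (ev w a s x)" using shifts_even[OF w] by (simp add: ev_append)
  also have "[\<dots> = ev w a s x + c a s] (mod N a)" using shiftsD v a by blast
  also have "[ev w a s x + c a s = x + d a s + c a s] (mod N a)" using shiftsD w a by (intro cong_add) auto
  finally show "[ev (v @ w) a s x = x + (c a s + d a s)] (mod N a)" by (simp add: algebra_simps)
qed

lemma shifts_rev:
  assumes w: "shifts w c"
  shows "shifts (rev w) (\<lambda>a s. - c a s)"
  unfolding shifts_def
proof (intro conjI ballI allI)
  show "even (length (rev w))" using shifts_even w by simp
  fix a s x assume a: "a \<in> carrier A"
  \<comment> \<open>The word \<open>w\<close> sends \<open>x - c a s\<close> to \<open>x\<close>,
    and \<open>rev w\<close> undoes it.\<close>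
  have "[ev (rev w) a s x = ev (rev w) a s (ev w a s (x - c a s))] (mod N a)"
    using shiftsD[OF w a, of s "x - c a s"] by (intro ev_cong) (simp add: cong_sym)
  also have "ev (rev w) a s (ev w a s (x - c a s)) = ev (rev w @ w) a s (x - c a s)"
    using shifts_even[OF w] by (simp add: ev_append)
  also have "[\<dots> = x - c a s] (mod N a)" using ev_word_eq[OF word_eq_rev a] by simp
  finally show "[ev (rev w) a s x = x + - c a s] (mod N a)" by simp
qed

lemma shifts_int_mult:
  assumes "shifts w c"
  shows "\<exists>v. shifts v (\<lambda>a s. k * c a s)"
proof -
  have nat: "\<exists>v. shifts v (\<lambda>a s. int m * c a s)" for m
  proof (induction m)
    case (Suc m)
    then obtain v where "shifts v (\<lambda>a s. int m * c a s)" by blast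
    from shifts_append[OF assms this] show ?case by (auto simp: algebra_simps)
  qed (use shifts_Nil in auto)
  show ?thesis
  proof (cases k rule: int_cases2)
    case (nonpos m)
    obtain v where "shifts v (\<lambda>a s. int m * c a s)" using nat by blast
    from shifts_rev[OF this] show ?thesis by (auto simp: nonpos)
  qed (use nat in auto)
qed

text \<open>Conjugating a translation by \<open>[R2, R0]\<close>, which acts as pure scaling,
  multiplies its vector by the scaling factor. With sums and integer multiples this yields all
  integer polynomials in the factor.\<close>

lemma shifts_scal:
  assumes w: "shifts w c"
  shows "\<exists>v. shifts v (\<lambda>a s. scal R0 a s * c a s)"
proof -
  have "shifts ([R2, R0] @ w @ [R0, R2]) (\<lambda>a s. scal R0 a s * c a s)"
    unfolding shifts_def
  proof (intro conjI ballI allI)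
    fix a s x assume a: "a \<in> carrier A"
    let ?m = "scal R0 a s" and ?m' = "scal R0 a (\<not> s)"
    have "ev ([R2, R0] @ w @ [R0, R2]) a s x = ?m * ev w a s (?m' * x)"
      using shifts_even[OF w] by (simp add: ev_append scal_def)
    also have "[\<dots> = ?m * (?m' * x + c a s)] (mod N a)"
      using shiftsD[OF w a] by (intro cong_scalar_left)
    also have "?m * (?m' * x + c a s) = ?m * ?m' * x + ?m * c a s" by (simp add: algebra_simps)
    also have "[\<dots> = 1 * x + ?m * c a s] (mod N a)"
      by (intro cong_add cong_scalar_right scal_inverse a cong_refl)
    finally show "[ev ([R2, R0] @ w @ [R0, R2]) a s x = x + ?m * c a s] (mod N a)" by simp
  qed (use shifts_even[OF w] in simp)
  then show ?thesis by blast
qed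

lemma shifts_linear:
  assumes w: "shifts w c"
  shows "\<exists>v. shifts v (\<lambda>a s. (k * scal R0 a s + l) * c a s)"
proof -
  obtain v1 where "shifts v1 (\<lambda>a s. scal R0 a s * c a s)" using shifts_scal[OF w] by blast
  from shifts_int_mult[OF this, of k] obtain v2
    where v2: "shifts v2 (\<lambda>a s. k * (scal R0 a s * c a s))" by blast
  obtain v3 where v3: "shifts v3 (\<lambda>a s. l * c a s)" using shifts_int_mult[OF w] by blast
  from shifts_append[OF v2 v3] show ?thesis by (auto simp: algebra_simps)
qed

lemma shifts_linear_prod:
  assumes w: "shifts w c" and F: "finite F"
  shows "\<exists>v. shifts v (\<lambda>a s. (\<Prod>b\<in>F. k b * scal R0 a s + l b) * c a s)"
  using F
proof (induction F)
  case (insert b F)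
  then obtain v where "shifts v (\<lambda>a s. (\<Prod>b\<in>F. k b * scal R0 a s + l b) * c a s)" by blast
  from shifts_linear[OF this, of "k b" "l b"] show ?case
    using insert by (auto simp: algebra_simps)
qed (use w in auto)

text \<open>The translation by 1 in all slots is multiplied by a polynomial in the scaling factor
  that vanishes in every slot except one.\<close>

lemma shifts_single:
  assumes g: "g \<in> carrier A"
  shows "\<exists>v. shifts v (\<lambda>a s. P a * (if \<not> s \<and> a = g then 1 else 0))"
proof -
  have "shifts [R1, R2] (\<lambda>a s. 1)" by (simp add: shifts_def scal_def add.commute)
  from shifts_linear_prod[OF this, of "carrier A - {g}" "\<lambda>b. 1" "\<lambda>b. - u b"]
  obtain v where v: "shifts v (\<lambda>a s. \<Prod>b\<in>carrier A - {g}. scal R0 a s - u b)"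
    using fin by auto
  from shifts_linear_prod[OF v fin, of u "\<lambda>b. -1"]
  obtain w where w: "shifts w (\<lambda>a s. (\<Prod>b\<in>carrier A. u b * scal R0 a s - 1) *
      (\<Prod>b\<in>carrier A - {g}. scal R0 a s - u b))" by auto
  have "shifts w (\<lambda>a s. P a * (if \<not> s \<and> a = g then 1 else 0))"
  proof (rule shifts_cong[OF w])
    fix a s assume a: "a \<in> carrier A"
    let ?c = "(\<Prod>b\<in>carrier A. u b * scal R0 a s - 1) * (\<Prod>b\<in>carrier A - {g}. scal R0 a s - u b)"
    consider "\<not> s" "a = g" | "\<not> s" "a \<noteq> g" | s by blast
    then show "[?c = P a * (if \<not> s \<and> a = g then 1 else 0)] (mod N a)"
    proof cases
      case 1
      then show ?thesis using P_eq[OF a] by (simp add: scal_def mult.commute)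
    next
      case 2
      then have "a \<in> carrier A - {g}" using a by simp
      moreover have "finite (carrier A - {g})" using fin by simp
      ultimately have "(\<Prod>b\<in>carrier A - {g}. u a - u b) = 0"
        using prod_zero by fastforce
      with 2 show ?thesis by (simp add: scal_def)
    next
      case 3
      \<comment> \<open>On this copy the scaling factor is \<open>u' a\<close>, so the factor with
        \<open>b = a\<close> vanishes modulo \<open>N a\<close>.\<close>
      have "N a dvd u a * scal R0 a s - 1"
        using u_inv[OF a] 3 by (simp add: N_def scal_def cong_iff_dvd_diff)
      also have "\<dots> dvd (\<Prod>b\<in>carrier A. u b * scal R0 a s - 1)"
        using fin a by (rule dvd_prodI)
      finally show ?thesis using 3 by (simp add: cong_0_iff)
    qed
  qed
  then show ?thesis by blast
qed

section \<open>The hypermap subgroup\<close>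

definition translates :: "gen list \<Rightarrow> ('a \<Rightarrow> bool \<Rightarrow> int) \<Rightarrow> bool" where
  "translates w q \<longleftrightarrow> shifts w (\<lambda>a s. P a * q a s)"

definition val :: "bool \<Rightarrow> ('a \<Rightarrow> bool \<Rightarrow> int) \<Rightarrow> 'a" where
  "val s q = (\<Otimes>a\<in>carrier A. a [^] q a s)"

text \<open>The residues of \<open>q\<close> modulo the order of \<open>A\<close> are determined by \<open>w\<close>, so the value that \<open>psi\<close>
  selects is unique on \<open>E\<close>; off \<open>E\<close> it is unspecified.\<close>

definition psi :: "bool \<Rightarrow> gen list set \<Rightarrow> 'a" where
  "psi s C = (THE g. \<exists>w q. C = word_class w \<and> translates w q \<and> g = val s q)"

definition E :: "gen list set set" where
  "E = {word_class w | w q. translates w q}"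

definition H :: "gen list set set" where
  "H = {word_class w | w q. translates w q \<and> val False q = \<one>}"

lemma val_closed [simp]: "val s q \<in> carrier A"
  unfolding val_def by (intro finprod_closed) auto

lemma val_add: "val s (\<lambda>a s. q a s + r a s) = val s q \<otimes> val s r"
  proof -
  have "val s (\<lambda>a s. q a s + r a s) = (\<Otimes>a\<in>carrier A. a [^] q a s \<otimes> a [^] r a s)"
    unfolding val_def by (intro finprod_cong) (auto simp: simp_implies_def int_pow_mult)
  then show ?thesis by (simp add: val_def Pi_def)
qed

lemma val_zero: "val s (\<lambda>a s. 0) = \<one>"
  unfolding val_def by (intro finprod_one_eqI) simp

lemma val_minus: "val s (\<lambda>a s. - q a s) = inv val s q"
proof (rule inv_equality[symmetric])
  show "val s (\<lambda>a s. - q a s) \<otimes> val s q = \<one>"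
    using val_add[of s "\<lambda>a s. - q a s" q] by (simp add: val_zero)
qed auto

lemma int_pow_cong_order:
  assumes a: "a \<in> carrier A" and k: "[k = l] (mod int (order A))"
  shows "a [^] k = a [^] l"
proof -
  obtain m where "l = k + int (order A) * m" using k by (auto simp: cong_iff_lin)
  moreover have "a [^] (int (order A) * m) = \<one>"
    using a by (simp add: int_pow_pow[symmetric] int_pow_int pow_order_eq_1)
  ultimately show ?thesis using a by (simp add: int_pow_mult)
qed

text \<open>Both vectors agree modulo \<open>N a\<close>; cancelling the nonzero \<open>P a\<close>
  leaves a congruence modulo the order of \<open>A\<close>, which is enough for exponents in
  \<open>A\<close>.\<close>

lemma val_unique:
  assumes "translates w q" "translates w r"
  shows "val s q = val s r"
  unfolding val_def
proof (rule finprod_cong')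
  fix a assume a: "a \<in> carrier A"
  have "[ev w a s 0 = P a * q a s] (mod N a)" "[ev w a s 0 = P a * r a s] (mod N a)"
    using assms a shiftsD[of w _ a s 0] unfolding translates_def by force+
  then have "[P a * q a s = P a * r a s] (mod N a)" using cong_sym cong_trans by blast
  then have "P a * int (order A) dvd P a * (q a s - r a s)"
    by (simp add: cong_iff_dvd_diff N_def algebra_simps)
  then have "[q a s = r a s] (mod int (order A))"
    using P_nz[OF a] by (simp add: cong_iff_dvd_diff)
  then show "a [^] q a s = a [^] r a s" by (rule int_pow_cong_order[OF a])
qed auto

lemma translates_word_eq: "word_eq v w \<Longrightarrow> translates v q \<Longrightarrow> translates w q"
  unfolding translates_def by (rule shifts_word_eq)

lemma psi_class: "translates w q \<Longrightarrow> psi s (word_class w) = val s q"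
  unfolding psi_def
proof (rule the_equality)
  fix g assume "translates w q"
    and "\<exists>v r. word_class w = word_class v \<and> translates v r \<and> g = val s r"
  then show "g = val s q"
    using translates_word_eq val_unique by (metis word_class_eq_iff)
qed auto

lemma translates_Nil: "translates [] (\<lambda>a s. 0)"
  by (simp add: translates_def shifts_Nil)

lemma translates_append:
  "translates v q \<Longrightarrow> translates w r \<Longrightarrow> translates (v @ w) (\<lambda>a s. q a s + r a s)"
  unfolding translates_def using shifts_append[of v _ w] by (simp add: distrib_left)

lemma translates_rev: "translates w q \<Longrightarrow> translates (rev w) (\<lambda>a s. - q a s)"
  unfolding translates_def using shifts_rev[of w] by simp

text \<open>Centrality: \<open>v\<close> commutes with the translation by
  \<open>ev_translate\<close>, with sign 1 because its length is even. So \<open>q\<close> itself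
  survives conjugation, which makes \<open>H\<close> normal.\<close>

lemma translates_conj:
  assumes w: "translates w q" and v: "even (length v)"
  shows "translates (v @ w @ rev v) q"
  unfolding translates_def shifts_def
proof (intro conjI ballI allI)
  have ew: "even (length w)" using w shifts_even by (auto simp: translates_def)
  then show "even (length (v @ w @ rev v))" using v by simp
  fix a s x assume a: "a \<in> carrier A"
  let ?y = "ev (rev v) a s x"
  have "ev (v @ w @ rev v) a s x = ev v a s (ev w a s ?y)"
    using ew v by (simp add: ev_append)
  also have "[\<dots> = ev v a s (?y + P a * q a s)] (mod N a)"
    using w a unfolding translates_def by (intro ev_cong shiftsD)
  also have "[ev v a s (?y + P a * q a s) = ev v a s ?y + P a * q a s] (mod N a)"
    using ev_translate[OF a, of v s ?y "q a s"] v by simp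
  also have "ev v a s ?y = ev (rev (rev v) @ rev v) a s x" using v by (simp add: ev_append)
  also have "[\<dots> + P a * q a s = x + P a * q a s] (mod N a)"
    using ev_word_eq[OF word_eq_rev a, of "rev v" s x] by (intro cong_add) auto
  finally show "[ev (v @ w @ rev v) a s x = x + P a * q a s] (mod N a)" .
qed

text \<open>\<open>R2\<close> negates and exchanges the copies, so conjugation by it swaps the two
  components of the vector and changes their sign.\<close>

lemma translates_reflect:
  assumes w: "translates w q"
  shows "translates ([R2] @ w @ [R2]) (\<lambda>a s. - q a (\<not> s))"
  unfolding translates_def shifts_def
proof (intro conjI ballI allI)
  have ew: "even (length w)" using w shifts_even by (auto simp: translates_def)
  then show "even (length ([R2] @ w @ [R2]))" by simp
  fix a s x assume a: "a \<in> carrier A"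
  have "ev ([R2] @ w @ [R2]) a s x = - ev w a (\<not> s) (- x)"
    using ew by (simp add: ev_append scal_def)
  also have "[\<dots> = - (- x + P a * q a (\<not> s))] (mod N a)"
    using w a unfolding translates_def by (intro cong_uminus shiftsD)
  finally show "[ev ([R2] @ w @ [R2]) a s x = x + P a * - q a (\<not> s)] (mod N a)" by simp
qed

lemma val_reflect: "val s (\<lambda>a s. - q a (\<not> s)) = inv val (\<not> s) q"
  using val_minus[of "\<not> s" q] by (simp add: val_def)

lemma translates_val_exists:
  assumes g: "g \<in> carrier A"
  shows "\<exists>w q. translates w q \<and> val False q = g \<and> val True q = \<one>"
proof -
  \<comment> \<open>Slots are indexed by the group elements themselves, so exponent 1 in the slot of
    \<open>g\<close> alone has value \<open>g\<close>.\<close>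
  let ?q = "\<lambda>a s. if \<not> s \<and> a = g then 1 else 0 :: int"
  have "val True ?q = \<one>" by (simp add: val_def)
  moreover have "val False ?q = (\<Otimes>a\<in>carrier A. if a = g then a else \<one>)"
    unfolding val_def by (intro finprod_cong) (auto simp: simp_implies_def)
  then have "val False ?q = g" using finprod_singleton_swap[OF g fin, of "\<lambda>a. a"] by simp
  moreover obtain w where "translates w ?q"
    using shifts_single[OF g] unfolding translates_def by blast
  ultimately show ?thesis by (intro exI[of _ w] exI[of _ ?q]) simp
qed

section \<open>\<open>H\<close> as a kernel, its normality and its finite index\<close>

lemma E_subgroup: "subgroup E Delta"
proof -
  interpret D: group Delta by (rule group_Delta)
  show ?thesis
  proof (rule D.subgroupI)
    show "E \<subseteq> carrier Delta" by (auto simp: E_def Delta_def)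
    show "E \<noteq> {}" using translates_Nil by (auto simp: E_def)
  next
    fix C assume "C \<in> E"
    then show "inv\<^bsub>Delta\<^esub> C \<in> E" using translates_rev by (fastforce simp: E_def inv_word_class)
  next
    fix C D assume "C \<in> E" "D \<in> E"
    then show "C \<otimes>\<^bsub>Delta\<^esub> D \<in> E"
      using translates_append by (fastforce simp: E_def word_class_mult)
  qed
qed

lemma psi_hom: "group_hom (Delta\<lparr>carrier := E\<rparr>) A (psi s)"
proof (intro group_hom.intro group_hom_axioms.intro homI)
  show "group (Delta\<lparr>carrier := E\<rparr>)"
    by (rule subgroup.subgroup_is_group[OF E_subgroup group_Delta])
  show "group A" ..
  fix C D assume "C \<in> carrier (Delta\<lparr>carrier := E\<rparr>)" "D \<in> carrier (Delta\<lparr>carrier := E\<rparr>)"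
  then obtain v q w r where vw: "C = word_class v" "translates v q" "D = word_class w" "translates w r"
    by (auto simp: E_def)
  then show "psi s (C \<otimes>\<^bsub>Delta\<lparr>carrier := E\<rparr>\<^esub> D) = psi s C \<otimes> psi s D"
    using psi_class[OF translates_append[OF vw(2,4)]]
    by (simp add: word_class_mult psi_class val_add)
qed (auto simp: E_def psi_class)

lemma H_kernel: "H = kernel (Delta\<lparr>carrier := E\<rparr>) A (psi False)"
proof -
  have "psi False (word_class w) = val False q" if "translates w q" for w q
    using that by (rule psi_class)
  then show ?thesis unfolding kernel_def H_def E_def by auto (metis+)
qed

lemma H_subset: "H \<subseteq> carrier Delta_plus"
  unfolding H_def Delta_plus_def translates_def using shifts_even by fastforce

lemma H_subgroup: "subgroup H Delta_plus"
proof -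
  interpret D: group Delta by (rule group_Delta)
  have "subgroup H (Delta\<lparr>carrier := E\<rparr>)"
    unfolding H_kernel by (rule group_hom.subgroup_kernel[OF psi_hom])
  then have "subgroup H Delta" using D.incl_subgroup E_subgroup by blast
  then show ?thesis
    using H_subset D.subgroup_incl[OF _ subgroup_even] by (simp add: Delta_plus_def)
qed

lemma inv_Delta_plus:
  "even (length w) \<Longrightarrow> inv\<^bsub>Delta_plus\<^esub> (word_class w) = word_class (rev w)"
  using group.m_inv_consistent[OF group_Delta subgroup_even, of "word_class w"]
  by (auto simp: Delta_plus_def inv_word_class)

lemma H_normal: "H \<lhd> Delta_plus"
proof -
  interpret P: group Delta_plus by (rule group_Delta_plus)
  have "C \<otimes>\<^bsub>Delta_plus\<^esub> D \<otimes>\<^bsub>Delta_plus\<^esub> inv\<^bsub>Delta_plus\<^esub> C \<in> H"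
    if C: "C \<in> carrier Delta_plus" and D: "D \<in> H" for C D
  proof -
    obtain v where v: "C = word_class v" "even (length v)" using C by (auto simp: Delta_plus_def)
    obtain w q where w: "D = word_class w" "translates w q" "val False q = \<one>"
      using D by (auto simp: H_def)
    have "C \<otimes>\<^bsub>Delta_plus\<^esub> D \<otimes>\<^bsub>Delta_plus\<^esub> inv\<^bsub>Delta_plus\<^esub> C = word_class (v @ w @ rev v)"
      using v w by (simp add: inv_Delta_plus) (simp add: Delta_plus_def word_class_mult)
    then show ?thesis using translates_conj[OF w(2) v(2)] w(3) by (auto simp: H_def)
  qed
  then show ?thesis using H_subgroup P.normal_inv_iff by blast
qed

lemma translates_if_same_action:
  assumes len: "even (length v)" "even (length w)"
    and same: "\<And>a s x. a \<in> carrier A \<Longrightarrow> [ev v a s x = ev w a s x] (mod N a)"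
  shows "translates (v @ rev w) (\<lambda>a s. 0)"
  unfolding translates_def shifts_def
proof (intro conjI ballI allI)
  fix a s x assume a: "a \<in> carrier A"
  have "[ev v a s (ev (rev w) a s x) = ev (rev (rev w) @ rev w) a s x] (mod N a)"
    using same[OF a] len by (simp add: ev_append)
  also have "[ev (rev (rev w) @ rev w) a s x = x] (mod N a)"
    using ev_word_eq[OF word_eq_rev a, of "rev w" s x] by simp
  finally show "[ev (v @ rev w) a s x = x + P a * 0] (mod N a)"
    using len by (simp add: ev_append)
qed (use len in simp)

text \<open>Even words act on finitely many residues. If two of them act alike, the quotient of one
  by the other translates by 0 and so lies in \<open>H\<close>; hence there are no more cosets than
  actions.\<close>

lemma finite_index: "finite (carrier (Delta_plus Mod H))"
proof -
  interpret P: group Delta_plus by (rule group_Delta_plus)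
  let ?W = "{w :: gen list. even (length w)}"
  define coset where "coset w = H #>\<^bsub>Delta_plus\<^esub> word_class w" for w
  define T where "T = (SIGMA a:carrier A. (UNIV :: bool set) \<times> {0..<\<bar>N a\<bar>})"
  \<comment> \<open>The action of \<open>w\<close> as a function on a finite set. The absolute value
    is taken because \<open>N a\<close> may be negative.\<close>
  define F where "F w = (\<lambda>(a, s, x)\<in>T. ev w a s x mod \<bar>N a\<bar>)" for w
  have finT: "finite T" using fin by (auto simp: T_def)
  have "F w \<in> (\<Pi>\<^sub>E (a, s, x)\<in>T. {0..<\<bar>N a\<bar>})" for w
    using N_nz by (auto simp: F_def T_def)
  then have "F ` ?W \<subseteq> (\<Pi>\<^sub>E (a, s, x)\<in>T. {0..<\<bar>N a\<bar>})" by blast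
  moreover have "finite (\<Pi>\<^sub>E (a, s, x)\<in>T. {0..<\<bar>N a\<bar>})"
    using finT by (intro finite_PiE) auto
  ultimately have finF: "finite (F ` ?W)" by (rule finite_subset)
  have eq: "coset v = coset w" if v: "v \<in> ?W" and w: "w \<in> ?W" and F: "F v = F w" for v w
  proof -
    have "[ev v a s x = ev w a s x] (mod N a)" if a: "a \<in> carrier A" for a s x
    proof -
      let ?x = "x mod \<bar>N a\<bar>"
      have x: "[x = ?x] (mod N a)"
        by (subst cong_abs[symmetric]) (simp add: cong_def)
      have "(a, s, ?x) \<in> T" using a N_nz by (simp add: T_def)
      then have "ev v a s ?x mod \<bar>N a\<bar> = ev w a s ?x mod \<bar>N a\<bar>"
        using fun_cong[OF F, of "(a, s, ?x)"] by (simp add: F_def)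
      then have "[ev v a s ?x = ev w a s ?x] (mod N a)"
        by (subst cong_abs[symmetric]) (simp only: cong_def)
      then show ?thesis using ev_cong[OF x] by (meson cong_sym cong_trans)
    qed
    then have "translates (v @ rev w) (\<lambda>a s. 0)"
      using v w by (intro translates_if_same_action) auto
    then have "word_class (v @ rev w) \<in> H" unfolding H_def using val_zero by blast
    then have "word_class v \<otimes>\<^bsub>Delta_plus\<^esub> inv\<^bsub>Delta_plus\<^esub> word_class w \<in> H"
      using w by (simp add: inv_Delta_plus) (simp add: Delta_plus_def word_class_mult)
    moreover have "word_class v \<in> carrier Delta_plus" "word_class w \<in> carrier Delta_plus"
      using v w by (auto simp: Delta_plus_def)
    ultimately show ?thesis
      unfolding coset_def
      using P.repr_independence H_subgroup subgroup.rcos_module[OF H_subgroup P.is_group] by metis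
  qed
  \<comment> \<open>By \<open>eq\<close> the coset of \<open>w\<close> depends only on
    \<open>F w\<close>, so the finiteness of the set of actions carries over.\<close>
  have "coset ` ?W = (\<lambda>y. coset (inv_into ?W F y)) ` F ` ?W"
  proof -
    have "coset w = coset (inv_into ?W F (F w))" if "w \<in> ?W" for w
      using that by (intro eq inv_into_into) (simp_all add: f_inv_into_f)
    then show ?thesis by (auto simp: image_image intro!: image_cong)
  qed
  then have "finite (coset ` ?W)" using finF by simp
  moreover have "carrier (Delta_plus Mod H) = coset ` ?W"
    by (auto simp: FactGroup_def RCOSETS_def Delta_plus_def coset_def)
  ultimately show ?thesis by simp
qed

section \<open>The reflected subgroup and the chirality group\<close>

text \<open>Reflection turns the value on one copy into the inverse of the value on the other, and
  an inverse is trivial exactly when the element is.\<close>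

lemma reflected_H:
  "reflected H = {word_class w | w q. translates w q \<and> val True q = \<one>}" (is "_ = ?K")
proof -
  have conj: "reflected H = {word_class ([R2] @ w @ [R2]) | w q. translates w q \<and> val False q = \<one>}"
    unfolding reflected_def Delta_gen_def l_coset_def r_coset_def H_def
    by (auto simp: word_class_mult) (metis append_Cons append_Nil word_class_mult)+
  show ?thesis
  proof (intro equalityI subsetI)
    fix C assume "C \<in> reflected H"
    then obtain w q where w: "C = word_class ([R2] @ w @ [R2])" "translates w q" "val False q = \<one>"
      unfolding conj by blast
    then show "C \<in> ?K"
      using translates_reflect[OF w(2)] val_reflect[of True q] by auto
  next
    fix C assume "C \<in> ?K"
    then obtain w q where w: "C = word_class w" "translates w q" "val True q = \<one>" by blast
    \<comment> \<open>Reflecting twice gives back \<open>w\<close>, so \<open>w\<close> is the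
      reflection of \<open>[R2] @ w @ [R2]\<close>.\<close>
    have "word_eq ([R2, R2] @ w @ [R2, R2]) ([] @ w @ [])"
      using word_square[of "[]" R2 "[]"] by (intro word_eq_append) (auto intro: word_refl)
    then have "C = word_class ([R2] @ ([R2] @ w @ [R2]) @ [R2])"
      using w(1) by (simp add: word_class_eq_iff word_sym)
    then show "C \<in> reflected H"
      unfolding conj using translates_reflect[OF w(2)] val_reflect[of False q] w(3)
      by (intro CollectI exI[of _ "[R2] @ w @ [R2]"] exI[of _ "\<lambda>a s. - q a (\<not> s)"]) auto
  qed
qed

lemma H_mult_reflected: "H <#>\<^bsub>Delta\<^esub> reflected H = E"
proof (intro equalityI subsetI)
  fix C assume "C \<in> H <#>\<^bsub>Delta\<^esub> reflected H"
  then show "C \<in> E"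
    using translates_append unfolding set_mult_def reflected_H
    by (fastforce simp: H_def E_def word_class_mult)
next
  fix C assume "C \<in> E"
  then obtain w q where w: "C = word_class w" "translates w q" by (auto simp: E_def)
  \<comment> \<open>The word \<open>v\<close> takes over the whole value of \<open>w\<close> on copy
    \<open>False\<close> while being trivial on copy \<open>True\<close>. Then
    \<open>w @ rev v\<close> lies in \<open>H\<close>, \<open>v\<close> in its reflection, and their
    product is \<open>w\<close>.\<close>
  obtain v r where v: "translates v r" "val False r = val False q" "val True r = \<one>"
    using translates_val_exists[of "val False q"] by auto
  have "word_class (w @ rev v) \<in> H"
    using translates_append[OF w(2) translates_rev[OF v(1)]] v(2)
      val_add[of False q "\<lambda>a s. - r a s"] val_minus[of False r]
    unfolding H_def by auto
  moreover have "word_class v \<in> reflected H" unfolding reflected_H using v by blast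
  moreover have "C = word_class (w @ rev v) \<otimes>\<^bsub>Delta\<^esub> word_class v"
    using word_eq_append[OF word_refl word_eq_rev, of w v]
    by (simp add: w(1) word_class_mult word_class_eq_iff word_sym)
  ultimately show "C \<in> H <#>\<^bsub>Delta\<^esub> reflected H" unfolding set_mult_def by blast
qed

lemma chirality_iso:
  "A \<cong> Delta\<lparr>carrier := H <#>\<^bsub>Delta\<^esub> reflected H\<rparr> Mod H"
proof -
  interpret h: group_hom "Delta\<lparr>carrier := E\<rparr>" A "psi False" by (rule psi_hom)
  have "psi False ` E = carrier A"
  proof (intro equalityI subsetI)
    fix g assume "g \<in> carrier A"
    then obtain w q where "translates w q" "val False q = g" using translates_val_exists by blast
    then have "word_class w \<in> E" "psi False (word_class w) = g" by (auto simp: E_def psi_class)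
    then show "g \<in> psi False ` E" by blast
  qed (use h.hom_closed in auto)
  then have "Delta\<lparr>carrier := E\<rparr> Mod H \<cong> A"
    using h.FactGroup_iso by (simp add: H_kernel)
  moreover have "group (Delta\<lparr>carrier := E\<rparr> Mod H)"
    unfolding H_kernel by (intro normal.factorgroup_is_group h.normal_kernel)
  ultimately show ?thesis
    unfolding H_mult_reflected by (rule group.iso_sym[rotated])
qed

end

section \<open>Choice of the multipliers and conclusion\<close>

text \<open>Euclid's construction: 1 plus \<open>n\<close> times the product of the earlier
  multipliers is coprime to each of them and is 1 modulo \<open>n\<close>.\<close>

lemma coprime_multipliers:
  assumes F: "finite F" and n: "n > 0"
  shows "\<exists>u :: 'a \<Rightarrow> int. (\<forall>a\<in>F. u a > 1 \<and> [u a = 1] (mod n)) \<and>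
    (\<forall>a\<in>F. \<forall>b\<in>F. a \<noteq> b \<longrightarrow> coprime (u a) (u b))"
  using F
proof (induction F)
  case (insert x F)
  then obtain u :: "'a \<Rightarrow> int" where u: "\<forall>a\<in>F. u a > 1 \<and> [u a = 1] (mod n)"
    "\<forall>a\<in>F. \<forall>b\<in>F. a \<noteq> b \<longrightarrow> coprime (u a) (u b)" by blast
  define p where "p = 1 + n * (\<Prod>a\<in>F. u a)"
  have "(\<Prod>a\<in>F. u a) > 0" using u(1) by (intro prod_pos) force
  then have p1: "p > 1" using n by (simp add: p_def)
  have pn: "[p = 1] (mod n)" by (simp add: p_def cong_iff_dvd_diff)
  have cop: "coprime p (u a)" if "a \<in> F" for a
  proof -
    have "u a dvd n * (\<Prod>a\<in>F. u a)" using dvd_prodI[OF insert(1) that] by (rule dvd_mult)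
    then have "[1 = p] (mod u a)" by (simp add: p_def cong_iff_dvd_diff)
    then show ?thesis by (rule cong_imp_coprime) simp
  qed
  show ?case
    using u p1 pn cop insert(2)
    by (intro exI[of _ "u(x := p)"]) (auto simp: coprime_commute)
qed simp

lemma affine_slots_exist:
  fixes A :: "('a, 'b) monoid_scheme"
  assumes A: "comm_group A" and fin: "finite (carrier A)"
  shows "\<exists>u u' P. affine_slots A u u' P"
proof -
  interpret comm_group A by fact
  let ?n = "int (order A)"
  have "?n > 0" using fin order_gt_0_iff_finite by simp
  from coprime_multipliers[OF fin this] obtain u :: "'a \<Rightarrow> int" where
    u: "\<And>a. a \<in> carrier A \<Longrightarrow> u a > 1" "\<And>a. a \<in> carrier A \<Longrightarrow> [u a = 1] (mod ?n)"
    "\<And>a b. a \<in> carrier A \<Longrightarrow> b \<in> carrier A \<Longrightarrow> a \<noteq> b \<Longrightarrow> coprime (u a) (u b)" by metis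
  define P where "P a = (\<Prod>b\<in>carrier A - {a}. u a - u b) * (\<Prod>b\<in>carrier A. u b * u a - 1)" for a
  have P_nz: "P a \<noteq> 0" if a: "a \<in> carrier A" for a
  proof -
    \<comment> \<open>Equal coprime integers would be units, which \<open>u a > 1\<close>
      excludes.\<close>
    have "u a \<noteq> u b" if "b \<in> carrier A - {a}" for b
      using u(1)[OF a] u(3)[of a b] a that by auto
    moreover have "u b * u a \<noteq> 1" if "b \<in> carrier A" for b
      using u(1)[OF a] u(1)[OF that] by (simp add: zmult_eq_1_iff)
    ultimately show ?thesis using fin by (simp add: P_def)
  qed
  \<comment> \<open>Modulo \<open>u a\<close> the factors of \<open>P a\<close> reduce to
    \<open>- u b\<close> and \<open>- 1\<close>, both coprime to \<open>u a\<close>. Hence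
    \<open>u a\<close> has an inverse \<open>u' a\<close> modulo \<open>?n * P a\<close>.\<close>
  have cop: "coprime (u a) (?n * P a)" if a: "a \<in> carrier A" for a
  proof -
    have "coprime (u a) ?n"
      using u(2)[OF a] by (metis cong_imp_coprime cong_sym coprime_1_left)
    moreover have "coprime (u a) (u a - u b)" if "b \<in> carrier A - {a}" for b
    proof -
      have "[- u b = u a - u b] (mod u a)" by (simp add: cong_iff_dvd_diff)
      moreover have "coprime (- u b) (u a)" using u(3)[OF a, of b] that by (auto simp: coprime_commute)
      ultimately show ?thesis using cong_imp_coprime by (metis coprime_commute)
    qed
    moreover have "coprime (u a) (u b * u a - 1)" for b
    proof -
      have "[- 1 = u b * u a - 1] (mod u a)" by (simp add: cong_iff_dvd_diff)
      moreover have "coprime (- 1) (u a)" by simp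
      ultimately show ?thesis using cong_imp_coprime by (metis coprime_commute)
    qed
    ultimately show ?thesis by (auto simp: P_def intro!: prod_coprime_right)
  qed
  have "\<forall>a. \<exists>y. a \<in> carrier A \<longrightarrow> [u a * y = 1] (mod ?n * P a)"
    using cop cong_solve_coprime_int by blast
  then obtain u' where u': "\<And>a. a \<in> carrier A \<Longrightarrow> [u a * u' a = 1] (mod ?n * P a)" by metis
  have "affine_slots A u u' P"
    using A fin P_nz u(2) u' unfolding affine_slots_def affine_slots_axioms_def
    by (simp add: P_def)
  then show ?thesis by blast
qed

theorem theorem20:
  fixes A :: "('a, 'b) monoid_scheme"
  assumes "comm_group A" and "finite (carrier A)"
  shows "\<exists>M :: nat hypermap. orientably_regular M \<and> A \<cong> chirality_group M"
proof -
  obtain u u' P where "affine_slots A u u' P" using affine_slots_exist assms by blast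
  then interpret affine_slots A u u' P .
  obtain M :: "nat hypermap" where "orientably_regular M" "hypermap_subgroup M = H"
    using nat_hypermap_with_subgroup H_normal finite_index by blast
  then show ?thesis using chirality_iso by (auto simp: chirality_group_def Let_def)
qed

end
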